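(* Let $G$ be a finite group. Then for all $n\geq 1$, $D^{\wedge}_n(G)\leq d_n(G)$.
   Context: For a group $G$ write ${}^hg=hgh^{-1}$. The tensor square $G\otimes G$ is the group generated by symbols $g\otimes h$ ($g,h\in G$) subject to $gk\otimes h=({}^gk\otimes {}^gh)(g\otimes h)$ and $g\otimes hk=(g\otimes h)({}^hg\otimes {}^hk)$ for all $g,h,k\in G$. The exterior square $G\wedge G$ is the quotient of $G\otimes G$ obtained by imposing the additional relations $g\otimes g=1$ for all $g\in G$; the image of $x\otimes y$ is denoted $x\wedge y$. For a finite group $G$ and an integer $n\ge 0$, the multiple exterior degree is $$D^{\wedge}_n(G)=\frac{|\{(x_1,\dots,x_{n+1})\in G^{n+1}: x_i\wedge x_j=1 \text{ in } G\wedge G \text{ for all } 1\le i,j\le n+1\}|}{|G|^{n+1}},$$ and the multiple commutativity degree is $$d_n(G)=\frac{|\{(x_1,\dots,x_{n+1})\in G^{n+1}: x_ix_j=x_jx_i \text{ for all } 1\le i,j\le n+1\}|}{|G|^{n+1}}.$$ *)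

theory Defs
  imports Complex_Main "HOL-Algebra.Coset"
begin

text \<open>
  Groups given by generators and relations. A letter \<open>(True, x)\<close> stands for the generator \<open>x\<close> and
  \<open>(False, x)\<close> for its formal inverse. Relations are given as equations, i.e. pairs of words.
\<close>

type_synonym 'x word = "(bool \<times> 'x) list"

definition words :: "'x set \<Rightarrow> 'x word set" where
  "words X = lists (UNIV \<times> X)"

inductive_set word_cong :: "'x set \<Rightarrow> ('x word \<times> 'x word) set \<Rightarrow> ('x word \<times> 'x word) set"
  for X :: "'x set" and R :: "('x word \<times> 'x word) set" where
  refl: "w \<in> words X \<Longrightarrow> (w, w) \<in> word_cong X R"
| sym: "(u, v) \<in> word_cong X R \<Longrightarrow> (v, u) \<in> word_cong X R"
| trans: "(u, v) \<in> word_cong X R \<Longrightarrow> (v, w) \<in> word_cong X R \<Longrightarrow> (u, w) \<in> word_cong X R"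
| append: "(u, u') \<in> word_cong X R \<Longrightarrow> (v, v') \<in> word_cong X R \<Longrightarrow> (u @ v, u' @ v') \<in> word_cong X R"
| cancel: "x \<in> X \<Longrightarrow> ([(b, x), (\<not> b, x)], []) \<in> word_cong X R"
| rel: "(u, v) \<in> R \<Longrightarrow> u \<in> words X \<Longrightarrow> v \<in> words X \<Longrightarrow> (u, v) \<in> word_cong X R"

definition word_class :: "'x set \<Rightarrow> ('x word \<times> 'x word) set \<Rightarrow> 'x word \<Rightarrow> 'x word set" where
  "word_class X R w = word_cong X R `` {w}"

definition presented_group :: "'x set \<Rightarrow> ('x word \<times> 'x word) set \<Rightarrow> 'x word set monoid" where
  "presented_group X R =
    \<lparr>carrier = words X // word_cong X R,
     mult = (\<lambda>A B. \<Union>a\<in>A. \<Union>b\<in>B. word_class X R (a @ b)),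
     one = word_class X R []\<rparr>"

definition normal_closure :: "('a, 'b) monoid_scheme \<Rightarrow> 'a set \<Rightarrow> 'a set" where
  "normal_closure G S = \<Inter>{N. N \<lhd> G \<and> S \<subseteq> N}"

definition conj_by :: "('a, 'b) monoid_scheme \<Rightarrow> 'a \<Rightarrow> 'a \<Rightarrow> 'a" where
  "conj_by G h g = h \<otimes>\<^bsub>G\<^esub> g \<otimes>\<^bsub>G\<^esub> inv\<^bsub>G\<^esub> h"

definition tensor_relations ::
    "('a, 'b) monoid_scheme \<Rightarrow> (('a \<times> 'a) word \<times> ('a \<times> 'a) word) set" where
  "tensor_relations G =
     {([(True, (g \<otimes>\<^bsub>G\<^esub> k, h))], [(True, (conj_by G g k, conj_by G g h)), (True, (g, h))])
        | g h k. g \<in> carrier G \<and> h \<in> carrier G \<and> k \<in> carrier G}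
   \<union> {([(True, (g, h \<otimes>\<^bsub>G\<^esub> k))], [(True, (g, h)), (True, (conj_by G h g, conj_by G h k))])
        | g h k. g \<in> carrier G \<and> h \<in> carrier G \<and> k \<in> carrier G}"

definition tensor_square :: "('a, 'b) monoid_scheme \<Rightarrow> ('a \<times> 'a) word set monoid" where
  "tensor_square G = presented_group (carrier G \<times> carrier G) (tensor_relations G)"

definition tensor :: "('a, 'b) monoid_scheme \<Rightarrow> 'a \<Rightarrow> 'a \<Rightarrow> ('a \<times> 'a) word set" where
  "tensor G g h = word_class (carrier G \<times> carrier G) (tensor_relations G) [(True, (g, h))]"

definition exterior_kernel :: "('a, 'b) monoid_scheme \<Rightarrow> ('a \<times> 'a) word set set" where
  "exterior_kernel G = normal_closure (tensor_square G) {tensor G g g | g. g \<in> carrier G}"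

definition exterior_square :: "('a, 'b) monoid_scheme \<Rightarrow> ('a \<times> 'a) word set set monoid" where
  "exterior_square G = tensor_square G Mod exterior_kernel G"

definition wedge :: "('a, 'b) monoid_scheme \<Rightarrow> 'a \<Rightarrow> 'a \<Rightarrow> ('a \<times> 'a) word set set" where
  "wedge G x y = exterior_kernel G #>\<^bsub>tensor_square G\<^esub> tensor G x y"

text \<open>Elements of \<open>G\<^sup>n\<^sup>+\<^sup>1\<close> are extensional functions on \<open>{1..n + 1}\<close>.\<close>

definition multiple_exterior_degree :: "('a, 'b) monoid_scheme \<Rightarrow> nat \<Rightarrow> real" where
  "multiple_exterior_degree G n =
     real (card {x \<in> {1..n + 1} \<rightarrow>\<^sub>E carrier G.
       \<forall>i\<in>{1..n + 1}. \<forall>j\<in>{1..n + 1}. wedge G (x i) (x j) = \<one>\<^bsub>exterior_square G\<^esub>})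
     / real (card (carrier G)) ^ (n + 1)"

definition multiple_commutativity_degree :: "('a, 'b) monoid_scheme \<Rightarrow> nat \<Rightarrow> real" where
  "multiple_commutativity_degree G n =
     real (card {x \<in> {1..n + 1} \<rightarrow>\<^sub>E carrier G.
       \<forall>i\<in>{1..n + 1}. \<forall>j\<in>{1..n + 1}. x i \<otimes>\<^bsub>G\<^esub> x j = x j \<otimes>\<^bsub>G\<^esub> x i})
     / real (card (carrier G)) ^ (n + 1)"


lemma word_cong_words: "(u, v) \<in> word_cong X R \<Longrightarrow> u \<in> words X \<and> v \<in> words X"
  by (induction rule: word_cong.induct) (auto simp: words_def)

lemma equiv_word_cong: "equiv (words X) (word_cong X R)"
proof (rule equivI)
  show "word_cong X R \<subseteq> words X \<times> words X"
    using word_cong_words[of _ _ X R] by auto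
  show "refl_on (words X) (word_cong X R)"
    using word_cong_words[of _ _ X R] by (auto simp: refl_on_def intro: word_cong.refl)
qed (auto simp: sym_def trans_def intro: word_cong.sym word_cong.trans)

lemma word_class_eq_iff:
  assumes "u \<in> words X" "v \<in> words X"
  shows "word_class X R u = word_class X R v \<longleftrightarrow> (u, v) \<in> word_cong X R"
  using eq_equiv_class_iff[OF equiv_word_cong assms] by (simp add: word_class_def)

lemma carrier_presented_group: "carrier (presented_group X R) = word_class X R ` words X"
  by (auto simp: presented_group_def quotient_def word_class_def)

lemma one_presented_group: "\<one>\<^bsub>presented_group X R\<^esub> = word_class X R []"
  by (simp add: presented_group_def)

lemma mult_presented_group:
  assumes "u \<in> words X" "v \<in> words X"
  shows "word_class X R u \<otimes>\<^bsub>presented_group X R\<^esub> word_class X R v = word_class X R (u @ v)"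
proof -
  have "word_class X R (a @ b) = word_class X R (u @ v)"
    if "a \<in> word_class X R u" "b \<in> word_class X R v" for a b
  proof -
    have "(u @ v, a @ b) \<in> word_cong X R"
      using that by (auto simp: word_class_def intro: word_cong.append)
    then show ?thesis
      by (metis equiv_word_cong equiv_class_eq word_class_def)
  qed
  moreover have "u \<in> word_class X R u" "v \<in> word_class X R v"
    using assms by (auto simp: word_class_def intro: word_cong.refl)
  ultimately have "(\<Union>a\<in>word_class X R u. \<Union>b\<in>word_class X R v. word_class X R (a @ b)) =
      word_class X R (u @ v)"
    by blast
  then show ?thesis
    by (simp add: presented_group_def)
qed

lemma word_inverse:
  assumes "w \<in> words X"
  shows "(rev (map (\<lambda>(b, x). (\<not> b, x)) w) @ w, []) \<in> word_cong X R"
  using assms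
proof (induction w)
  case Nil
  then show ?case by (auto simp: words_def intro: word_cong.refl)
next
  case (Cons a w)
  obtain b x where a: "a = (b, x)" by (cases a)
  let ?w' = "rev (map (\<lambda>(b, x). (\<not> b, x)) w)"
  have x: "x \<in> X" and w: "w \<in> words X" using Cons.prems a by (auto simp: words_def)
  then have w': "?w' \<in> words X" by (auto simp: words_def in_lists_conv_set)
  have "([(\<not> b, x), (b, x)], []) \<in> word_cong X R"
    using word_cong.cancel[OF x, of "\<not> b"] by simp
  from word_cong.append[OF word_cong.append[OF word_cong.refl[OF w'] this] word_cong.refl[OF w]]
  have "(?w' @ [(\<not> b, x), (b, x)] @ w, ?w' @ w) \<in> word_cong X R" by simp
  then show ?case using Cons.IH[OF w] by (auto simp: a intro: word_cong.trans)
qed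

lemma group_presented_group: "group (presented_group X R)"
proof (rule groupI)
  fix A B
  assume "A \<in> carrier (presented_group X R)" "B \<in> carrier (presented_group X R)"
  then show "A \<otimes>\<^bsub>presented_group X R\<^esub> B \<in> carrier (presented_group X R)"
    by (auto simp: carrier_presented_group mult_presented_group) (auto simp: words_def)
next
  show "\<one>\<^bsub>presented_group X R\<^esub> \<in> carrier (presented_group X R)"
    by (auto simp: carrier_presented_group one_presented_group words_def)
next
  fix A B C
  assume "A \<in> carrier (presented_group X R)" "B \<in> carrier (presented_group X R)"
    "C \<in> carrier (presented_group X R)"
  then obtain a b c where "a \<in> words X" "b \<in> words X" "c \<in> words X"
    and "A = word_class X R a" "B = word_class X R b" "C = word_class X R c"
    by (auto simp: carrier_presented_group)
  moreover from this have "a @ b \<in> words X" "b @ c \<in> words X" by (auto simp: words_def)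
  ultimately show "A \<otimes>\<^bsub>presented_group X R\<^esub> B \<otimes>\<^bsub>presented_group X R\<^esub> C =
      A \<otimes>\<^bsub>presented_group X R\<^esub> (B \<otimes>\<^bsub>presented_group X R\<^esub> C)"
    by (simp add: mult_presented_group)
next
  have Nil: "[] \<in> words X" by (simp add: words_def)
  fix A
  assume "A \<in> carrier (presented_group X R)"
  then obtain a where a: "a \<in> words X" "A = word_class X R a"
    by (auto simp: carrier_presented_group)
  then show "\<one>\<^bsub>presented_group X R\<^esub> \<otimes>\<^bsub>presented_group X R\<^esub> A = A"
    using mult_presented_group[OF Nil a(1), of R] by (simp add: one_presented_group)
  let ?a' = "rev (map (\<lambda>(b, x). (\<not> b, x)) a)"
  have a': "?a' \<in> words X" using a by (auto simp: words_def in_lists_conv_set)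
  then have "word_class X R ?a' \<otimes>\<^bsub>presented_group X R\<^esub> A = \<one>\<^bsub>presented_group X R\<^esub>"
    using a Nil word_inverse[OF a(1), of R] word_cong_words[OF word_inverse[OF a(1), of R]]
    by (simp add: mult_presented_group one_presented_group word_class_eq_iff)
  then show "\<exists>B\<in>carrier (presented_group X R).
      B \<otimes>\<^bsub>presented_group X R\<^esub> A = \<one>\<^bsub>presented_group X R\<^esub>"
    using a' unfolding carrier_presented_group by blast
qed

lemma normal_normal_closure:
  assumes "group G" "S \<subseteq> carrier G"
  shows "normal_closure G S \<lhd> G"
proof -
  interpret group G by fact
  let ?F = "{N. N \<lhd> G \<and> S \<subseteq> N}"
  have "carrier G \<lhd> G"
    by (rule normal_invI[OF subgroup_self]) simp
  with assms(2) have "?F \<noteq> {}"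
    by blast
  then have "subgroup (\<Inter>?F) G"
    by (intro subgroups_Inter) (auto dest: normal_imp_subgroup)
  moreover have "x \<otimes>\<^bsub>G\<^esub> h \<otimes>\<^bsub>G\<^esub> inv\<^bsub>G\<^esub> x \<in> \<Inter>?F"
    if "x \<in> carrier G" "h \<in> \<Inter>?F" for x h
    using that normal.inv_op_closed2 by fastforce
  ultimately show ?thesis
    unfolding normal_closure_def by (rule normal_invI)
qed

lemma group_tensor_square: "group (tensor_square G)"
  by (simp add: tensor_square_def group_presented_group)

lemma tensor_closed:
  "g \<in> carrier G \<Longrightarrow> h \<in> carrier G \<Longrightarrow> tensor G g h \<in> carrier (tensor_square G)"
  by (auto simp: tensor_def tensor_square_def carrier_presented_group words_def)

lemma tensor_mult_left:
  assumes "group G" and ghk: "g \<in> carrier G" "h \<in> carrier G" "k \<in> carrier G"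
  shows "tensor G (g \<otimes>\<^bsub>G\<^esub> k) h =
    tensor G (conj_by G g k) (conj_by G g h) \<otimes>\<^bsub>tensor_square G\<^esub> tensor G g h"
proof -
  interpret group G by fact
  let ?X = "carrier G \<times> carrier G" and ?R = "tensor_relations G"
  let ?u = "[(True, (g \<otimes>\<^bsub>G\<^esub> k, h))]"
    and ?v = "[(True, (conj_by G g k, conj_by G g h))]" and ?w = "[(True, (g, h))]"
  have words: "?u \<in> words ?X" "?v \<in> words ?X" "?w \<in> words ?X" "?v @ ?w \<in> words ?X"
    using ghk by (simp_all add: words_def conj_by_def)
  have "(?u, ?v @ ?w) \<in> ?R"
    unfolding tensor_relations_def using ghk by auto
  then have "(?u, ?v @ ?w) \<in> word_cong ?X ?R"
    using words by (intro word_cong.rel)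
  then have "word_class ?X ?R ?u = word_class ?X ?R (?v @ ?w)"
    by (simp only: word_class_eq_iff words)
  then show ?thesis
    unfolding tensor_def tensor_square_def by (simp only: mult_presented_group words)
qed

lemma tensor_mult_right:
  assumes "group G" and ghk: "g \<in> carrier G" "h \<in> carrier G" "k \<in> carrier G"
  shows "tensor G g (h \<otimes>\<^bsub>G\<^esub> k) =
    tensor G g h \<otimes>\<^bsub>tensor_square G\<^esub> tensor G (conj_by G h g) (conj_by G h k)"
proof -
  interpret group G by fact
  let ?X = "carrier G \<times> carrier G" and ?R = "tensor_relations G"
  let ?u = "[(True, (g, h \<otimes>\<^bsub>G\<^esub> k))]"
    and ?v = "[(True, (g, h))]" and ?w = "[(True, (conj_by G h g, conj_by G h k))]"
  have words: "?u \<in> words ?X" "?v \<in> words ?X" "?w \<in> words ?X" "?v @ ?w \<in> words ?X"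
    using ghk by (simp_all add: words_def conj_by_def)
  have "(?u, ?v @ ?w) \<in> ?R"
    unfolding tensor_relations_def using ghk by auto
  then have "(?u, ?v @ ?w) \<in> word_cong ?X ?R"
    using words by (intro word_cong.rel)
  then have "word_class ?X ?R ?u = word_class ?X ?R (?v @ ?w)"
    by (simp only: word_class_eq_iff words)
  then show ?thesis
    unfolding tensor_def tensor_square_def by (simp only: mult_presented_group words)
qed

lemma normal_exterior_kernel: "exterior_kernel G \<lhd> tensor_square G"
  unfolding exterior_kernel_def
  by (rule normal_normal_closure) (auto intro: group_tensor_square tensor_closed)

lemma group_exterior_square: "group (exterior_square G)"
  unfolding exterior_square_def by (rule normal.factorgroup_is_group[OF normal_exterior_kernel])

end

theory Submission
  imports Defs
begin

text \<open>
  If \<open>x \<and> y = 1\<close> in the exterior square, then \<open>x\<close> and \<open>y\<close> commute in \<open>G\<close>. Hence every tuple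
  counted by the exterior degree is also counted by the commutativity degree, and since both
  counts are divided by the same power of \<open>|G|\<close>, the inequality follows.

  The implication comes from the commutator map \<open>\<kappa> : G \<otimes> G \<rightarrow> G\<close>, \<open>\<kappa>(g \<otimes> h) = g h g\<inverse> h\<inverse>\<close>. It is
  a well-defined homomorphism because commutators satisfy the two defining relations of the tensor
  square (\<open>commutator_tensor_relations\<close>), so that the universal property of a group given by
  generators and relations (\<open>presented_group_lift\<close>) applies. As \<open>\<kappa>(g \<otimes> g) = 1\<close>, the kernel
  of \<open>\<kappa>\<close> is a normal subgroup that contains all \<open>g \<otimes> g\<close>, hence contains the normal closure by
  which one divides to obtain \<open>G \<and> G\<close>. So \<open>x \<and> y = 1\<close>, that is, membership of
  \<open>x \<otimes> y\<close> in this normal closure, forces \<open>\<kappa>(x \<otimes> y) = 1\<close>.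
\<close>

fun word_value :: "('a, 'b) monoid_scheme \<Rightarrow> ('x \<Rightarrow> 'a) \<Rightarrow> 'x word \<Rightarrow> 'a" where
  "word_value H f [] = \<one>\<^bsub>H\<^esub>"
| "word_value H f ((b, x) # w) =
    (if b then f x else inv\<^bsub>H\<^esub> f x) \<otimes>\<^bsub>H\<^esub> word_value H f w"

context group
begin

lemma word_value_closed:
  assumes "f \<in> X \<rightarrow> carrier G" "w \<in> words X"
  shows "word_value G f w \<in> carrier G"
  using assms(2)
proof (induction w)
  case (Cons a w)
  then show ?case using assms(1) by (cases a) (auto simp: words_def)
qed simp

lemma word_value_append:
  assumes "f \<in> X \<rightarrow> carrier G" "u \<in> words X" "v \<in> words X"
  shows "word_value G f (u @ v) = word_value G f u \<otimes> word_value G f v"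
  using assms(2)
proof (induction u)
  case Nil
  then show ?case using word_value_closed[OF assms(1,3)] by simp
next
  case (Cons a u)
  obtain b x where a: "a = (b, x)" by (cases a)
  have u: "u \<in> words X" and "f x \<in> carrier G"
    using Cons.prems assms(1) by (auto simp: words_def a)
  then show ?case
    using Cons.IH word_value_closed[OF assms(1) u] word_value_closed[OF assms(1,3)]
    by (simp add: a m_assoc)
qed

lemma word_value_cong:
  assumes f: "f \<in> X \<rightarrow> carrier G"
    and R: "\<And>u v. (u, v) \<in> R \<Longrightarrow> u \<in> words X \<Longrightarrow> v \<in> words X
      \<Longrightarrow> word_value G f u = word_value G f v"
    and "(u, v) \<in> word_cong X R"
  shows "word_value G f u = word_value G f v"
  using assms(3)
proof (induction rule: word_cong.induct)
  case (append u u' v v')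
  then show ?case
    using word_cong_words[OF append.hyps(1)] word_cong_words[OF append.hyps(2)]
    by (simp add: word_value_append[OF f])
next
  case (cancel x b)
  then have "f x \<in> carrier G" using f by auto
  then show ?case by simp
next
  case (rel u v)
  then show ?case by (rule R)
qed simp_all

text \<open>
  The homomorphism sends a class to the common value of its words; these agree because evaluation
  respects each rule that generates the congruence.
\<close>

lemma presented_group_lift:
  assumes f: "f \<in> X \<rightarrow> carrier G"
    and R: "\<And>u v. (u, v) \<in> R \<Longrightarrow> u \<in> words X \<Longrightarrow> v \<in> words X
      \<Longrightarrow> word_value G f u = word_value G f v"
  obtains \<phi> where "\<phi> \<in> hom (presented_group X R) G"
    and "\<And>w. w \<in> words X \<Longrightarrow> \<phi> (word_class X R w) = word_value G f w"
proof
  define \<phi> where "\<phi> A = the_elem (word_value G f ` A)" for A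
  show class_value: "\<phi> (word_class X R w) = word_value G f w" if w: "w \<in> words X" for w
  proof -
    have "word_value G f v = word_value G f w" if "v \<in> word_class X R w" for v
    proof (rule word_value_cong[OF f, symmetric])
      show "(w, v) \<in> word_cong X R" using that by (simp add: word_class_def)
    qed (fact R)
    moreover have "w \<in> word_class X R w"
      using w by (simp add: word_class_def word_cong.refl)
    ultimately have "word_value G f ` word_class X R w = {word_value G f w}"
      by blast
    then show ?thesis by (simp add: \<phi>_def)
  qed
  have append: "u @ v \<in> words X" if "u \<in> words X" "v \<in> words X" for u v
    using that by (auto simp: words_def)
  show "\<phi> \<in> hom (presented_group X R) G"
    by (rule homI)
      (auto simp: carrier_presented_group mult_presented_group class_value append
        word_value_append[OF f] word_value_closed[OF f])
qed

definition commutator :: "'a \<Rightarrow> 'a \<Rightarrow> 'a" where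
  "commutator x y = x \<otimes> y \<otimes> inv x \<otimes> inv y"

lemma commutator_closed: "x \<in> carrier G \<Longrightarrow> y \<in> carrier G \<Longrightarrow> commutator x y \<in> carrier G"
  by (simp add: commutator_def)

lemma commutator_eq_one_iff:
  assumes "x \<in> carrier G" "y \<in> carrier G"
  shows "commutator x y = \<one> \<longleftrightarrow> x \<otimes> y = y \<otimes> x"
proof -
  have "commutator x y = (x \<otimes> y) \<otimes> inv (y \<otimes> x)"
    using assms by (simp add: commutator_def inv_mult_group m_assoc)
  then show ?thesis
    using assms by (metis inv_solve_right' l_one m_closed one_closed)
qed

lemma inv_mult_cancel_left:
  assumes "x \<in> carrier G" "y \<in> carrier G"
  shows "inv x \<otimes> (x \<otimes> y) = y" "x \<otimes> (inv x \<otimes> y) = y"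
  using assms by (simp_all flip: m_assoc)

text \<open>
  Since conjugation by \<open>g\<close> is an automorphism, these are the classical expansions
  \<open>[gk, h] = g [k, h] g\<inverse> [g, h]\<close> and \<open>[g, hk] = [g, h] h [g, k] h\<inverse>\<close>; in the form below they are
  the defining relations of the tensor square with \<open>\<otimes>\<close> replaced by the commutator.
\<close>

lemma commutator_tensor_relations:
  assumes "g \<in> carrier G" "h \<in> carrier G" "k \<in> carrier G"
  shows "commutator (g \<otimes> k) h = commutator (conj_by G g k) (conj_by G g h) \<otimes> commutator g h"
    and "commutator g (h \<otimes> k) = commutator g h \<otimes> commutator (conj_by G h g) (conj_by G h k)"
  using assms
  by (simp_all add: commutator_def conj_by_def inv_mult_group m_assoc inv_mult_cancel_left)

lemma conj_by_closed: "g \<in> carrier G \<Longrightarrow> k \<in> carrier G \<Longrightarrow> conj_by G g k \<in> carrier G"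
  by (simp add: conj_by_def)

lemma commutator_map:
  obtains \<kappa> where "\<kappa> \<in> hom (tensor_square G) G"
    and "\<And>x y. x \<in> carrier G \<Longrightarrow> y \<in> carrier G \<Longrightarrow> \<kappa> (tensor G x y) = commutator x y"
proof -
  let ?X = "carrier G \<times> carrier G" and ?f = "\<lambda>(x, y). commutator x y"
  have f: "?f \<in> ?X \<rightarrow> carrier G"
    by (auto simp: commutator_closed)
  show thesis
  proof (rule presented_group_lift[OF f])
    show "word_value G ?f u = word_value G ?f v" if "(u, v) \<in> tensor_relations G" for u v
      using that
      by (auto simp: tensor_relations_def commutator_closed commutator_tensor_relations
          conj_by_closed)
    fix \<phi>
    assume \<phi>: "\<phi> \<in> hom (presented_group ?X (tensor_relations G)) G"
      "\<And>w. w \<in> words ?X \<Longrightarrow> \<phi> (word_class ?X (tensor_relations G) w) = word_value G ?f w"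
    show thesis
    proof (rule that)
      show "\<phi> \<in> hom (tensor_square G) G"
        using \<phi>(1) by (simp add: tensor_square_def)
      show "\<phi> (tensor G x y) = commutator x y" if "x \<in> carrier G" "y \<in> carrier G" for x y
        using that \<phi>(2)[of "[(True, (x, y))]"]
        by (simp add: tensor_def words_def commutator_closed)
    qed
  qed
qed

text \<open>
  The commutator map is trivial on every \<open>g \<otimes> g\<close>, so it factors through the exterior square.
\<close>

lemma wedge_eq_one_imp_commute:
  assumes x: "x \<in> carrier G" and y: "y \<in> carrier G"
    and wedge: "wedge G x y = \<one>\<^bsub>exterior_square G\<^esub>"
  shows "x \<otimes> y = y \<otimes> x"
proof -
  obtain \<kappa> where \<kappa>: "\<kappa> \<in> hom (tensor_square G) G"
    and tensor: "\<And>x y. x \<in> carrier G \<Longrightarrow> y \<in> carrier G \<Longrightarrow> \<kappa> (tensor G x y) = commutator x y"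
    using commutator_map by blast
  interpret T: group "tensor_square G" by (rule group_tensor_square)
  interpret \<kappa>: group_hom "tensor_square G" G \<kappa>
    using \<kappa> by unfold_locales
  let ?K = "exterior_kernel G"
  have "tensor G g g \<in> kernel (tensor_square G) G \<kappa>" if "g \<in> carrier G" for g
    using that by (simp add: kernel_def tensor tensor_closed commutator_eq_one_iff)
  then have le: "?K \<subseteq> kernel (tensor_square G) G \<kappa>"
    unfolding exterior_kernel_def normal_closure_def
    using \<kappa>.normal_kernel by (intro Inter_lower) auto
  have "?K #>\<^bsub>tensor_square G\<^esub> tensor G x y = ?K"
    using wedge by (simp add: wedge_def exterior_square_def FactGroup_def)
  then have "tensor G x y \<in> ?K"
    using T.rcos_self[OF tensor_closed[OF x y]
      normal_imp_subgroup[OF normal_exterior_kernel]] by simp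
  with le have "\<kappa> (tensor G x y) = \<one>"
    by (auto simp: kernel_def)
  then show ?thesis
    using x y by (simp add: tensor commutator_eq_one_iff)
qed

end

theorem proposition3p4:
  fixes G (structure) and n :: nat
  assumes "group G" and "finite (carrier G)" and "n \<ge> 1"
  shows "multiple_exterior_degree G n \<le> multiple_commutativity_degree G n"
proof -
  interpret group G by fact
  let ?I = "{1..n + 1}"
  have "finite (?I \<rightarrow>\<^sub>E carrier G)"
    using assms(2) by (intro finite_PiE) auto
  then have "card {x \<in> ?I \<rightarrow>\<^sub>E carrier G.
        \<forall>i\<in>?I. \<forall>j\<in>?I. wedge G (x i) (x j) = \<one>\<^bsub>exterior_square G\<^esub>}
      \<le> card {x \<in> ?I \<rightarrow>\<^sub>E carrier G. \<forall>i\<in>?I. \<forall>j\<in>?I. x i \<otimes> x j = x j \<otimes> x i}"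
    by (intro card_mono) (auto intro!: wedge_eq_one_imp_commute dest: PiE_mem)
  then show ?thesis
    unfolding multiple_exterior_degree_def multiple_commutativity_degree_def
    by (intro divide_right_mono) simp_all
qed

end
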